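(* For each integer $a\geqslant 2$, $$\delta([a])=2\sum_{b=3}^{a}(b,\underbrace{1,\ldots,1}_{a-b})+3\,(2,\underbrace{1,\ldots,1}_{a-2}).$$
   Context: A composition is a finite sequence $\mathbf{a}=(a_1,\ldots,a_r)$ of positive integers ($r\geqslant0$), of weight $\sum a_i$; admissible if $r=0$ or $a_1\geqslant2$. $\mathcal{A}$ (resp. $\mathcal{A}_k$) is the set of admissible compositions (resp. of weight $k$). Binary word $\mathbf{w}(\mathbf{a})=0^{a_1-1}1\cdots0^{a_r-1}1$; the dual of a word $\varepsilon_1\cdots\varepsilon_k$ is $\overline{\varepsilon_k}\cdots\overline{\varepsilon_1}$ ($\overline0=1,\overline1=0$); $\overline{\mathbf{a}}$ is the admissible composition with word dual to $\mathbf{w}(\mathbf{a})$. $\mathcal{B}=\mathcal{A}/(\mathbf{a}\sim\overline{\mathbf{a}})$, classes $[\mathbf{a}]$, $\mathcal{B}_k$ classes of weight $k$; $\mathbf{Z}^{(X)}$ is the free $\mathbf{Z}$-module on $X$; $(a)$ denotes the composition of depth one with entry $a$. $(a_1,\ldots,a_r)^{\rm init}=(a_1,\ldots,a_{r-1})$ ($\varnothing^{\rm init}=\varnothing$); for admissible $\mathbf{a}$, $\mathbf{a}^{\rm fin}$ is the dual of $(\overline{\mathbf{a}})^{\rm init}$, $\mathbf{a}^{\rm mid}=(\mathbf{a}^{\rm fin})^{\rm init}$; extended $\mathbf{Z}$-linearly. $\delta$ is the unique $\mathbf{Z}$-linear map $\mathbf{Z}^{(\mathcal{B})}\to\mathbf{Z}^{(\mathcal{A})}$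 with $\delta(\mathbf{Z}^{\mathcal{B}_k})\subset\mathbf{Z}^{\mathcal{A}_k}$ for all $k$, $\delta([\varnothing])=\varnothing$, and $\delta([\mathbf{a}])^{\rm init}=\delta([\mathbf{a}^{\rm init}])+\delta([\mathbf{a}^{\rm mid}])+\delta([\mathbf{a}^{\rm fin}])$ for all non-empty admissible $\mathbf{a}$. *)

theory Defs
  imports Complex_Main "HOL-Library.Poly_Mapping"
begin

section \<open>Admissible compositions, binary words and duality\<close>

typedef acomp = "{a :: nat list. (\<forall>i\<in>set a. 1 \<le> i) \<and> (a = [] \<or> 2 \<le> hd a)}"
  morphisms entries Acomp
  by (rule exI[of _ "[]"]) simp

setup_lifting type_definition_acomp

lift_definition empty_acomp :: acomp is "[]" by simp

lift_definition weight :: "acomp \<Rightarrow> nat" is sum_list .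

text \<open>The letters 0 and 1 are encoded as \<^term>\<open>False\<close> and \<^term>\<open>True\<close>.\<close>

definition list_word :: "nat list \<Rightarrow> bool list" where
  "list_word a = concat (map (\<lambda>n. replicate (n - 1) False @ [True]) a)"

lift_definition word :: "acomp \<Rightarrow> bool list" is list_word .

definition dual_word :: "bool list \<Rightarrow> bool list" where
  "dual_word w = rev (map Not w)"

definition dual :: "acomp \<Rightarrow> acomp" where
  "dual a = (THE b. word b = dual_word (word a))"

lemma list_word_simps [simp]:
  "list_word [] = []"
  "list_word (n # a) = replicate (n - 1) False @ True # list_word a"
  "list_word (a @ b) = list_word a @ list_word b"
  by (simp_all add: list_word_def)

lemma replicate_False_True_eq:
  "replicate n False @ True # u = replicate m False @ True # v \<longleftrightarrow> n = m \<and> u = v"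
proof (induction n arbitrary: m)
  case 0
  then show ?case by (cases m) auto
next
  case (Suc n)
  then show ?case by (cases m) auto
qed

lemma list_word_inject:
  assumes "\<forall>i\<in>set a. 1 \<le> i" "\<forall>i\<in>set b. 1 \<le> i" "list_word a = list_word b"
  shows "a = b"
  using assms
proof (induction a arbitrary: b)
  case Nil
  then show ?case by (cases b) auto
next
  case (Cons n a)
  from Cons.prems(3) obtain m b' where b: "b = m # b'"
    by (cases b) auto
  from Cons.prems have "n - 1 = m - 1" "list_word a = list_word b'"
    unfolding b list_word_simps replicate_False_True_eq by blast+
  moreover from Cons.prems have "1 \<le> n" "1 \<le> m"
    by (simp_all add: b)
  ultimately show ?case
    using Cons.IH[of b'] Cons.prems by (simp add: b)
qed

lemma list_word_surj:
  assumes "w = [] \<or> last w"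
  shows "\<exists>a. (\<forall>i\<in>set a. 1 \<le> i) \<and> list_word a = w"
  using assms
proof (induction w)
  case Nil
  show ?case by (rule exI[of _ "[]"]) simp
next
  case (Cons x w)
  then have "w = [] \<or> last w"
    by (auto split: if_splits)
  with Cons.IH obtain a where a: "\<forall>i\<in>set a. 1 \<le> i" "list_word a = w"
    by blast
  show ?case
  proof (cases x)
    case True
    with a show ?thesis
      by (intro exI[of _ "1 # a"]) auto
  next
    case False
    with Cons.prems have "w \<noteq> []"
      by (auto split: if_splits)
    with a obtain n a' where "a = n # a'"
      by (cases a) auto
    with a False show ?thesis
      by (intro exI[of _ "Suc n # a'"]) (cases n; auto)
  qed
qed

lemma last_list_word: "a \<noteq> [] \<Longrightarrow> last (list_word a)"
  by (induction a) (auto simp: list_word_def)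

lemma hd_list_word: "a \<noteq> [] \<Longrightarrow> hd (list_word a) \<longleftrightarrow> hd a \<le> 1"
proof (cases a)
  case (Cons n b)
  then show ?thesis by (cases "n - 1") auto
qed simp

lemma list_word_eq_Nil_iff [simp]: "list_word a = [] \<longleftrightarrow> a = []"
  by (cases a) auto

lemma length_list_word: "\<forall>i\<in>set a. 1 \<le> i \<Longrightarrow> length (list_word a) = sum_list a"
  by (induction a) auto

lemma word_inject: "word a = word b \<longleftrightarrow> a = b"
  by transfer (blast dest: list_word_inject)

lemma length_word: "length (word a) = weight a"
  by transfer (simp add: length_list_word)

lemma word_eq_Nil_iff: "word a = [] \<longleftrightarrow> a = empty_acomp"
  by transfer simp

lemma word_surj:
  assumes "w = [] \<or> (\<not> hd w \<and> last w)"
  shows "\<exists>a. word a = w"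
proof -
  from assms obtain a where a: "\<forall>i\<in>set a. 1 \<le> i" "list_word a = w"
    using list_word_surj by blast
  with assms have "a = [] \<or> 2 \<le> hd a"
    using hd_list_word[of a] by (cases "a = []") auto
  with a have "word (Acomp a) = w"
    by (simp add: word.rep_eq Acomp_inverse)
  then show ?thesis ..
qed

lemma word_ends: "word a = [] \<or> (\<not> hd (word a) \<and> last (word a))"
  by transfer (auto simp: hd_list_word last_list_word)

lemma word_dual: "word (dual a) = dual_word (word a)"
proof -
  have "dual_word (word a) = [] \<or> (\<not> hd (dual_word (word a)) \<and> last (dual_word (word a)))"
    using word_ends[of a] by (auto simp: dual_word_def hd_rev last_rev hd_map last_map)
  then obtain b where "word b = dual_word (word a)"
    using word_surj by blast
  then show ?thesis
    unfolding dual_def by (rule theI) (use \<open>word b = _\<close> in \<open>simp flip: word_inject\<close>)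
qed

lemma dual_dual [simp]: "dual (dual a) = a"
  by (simp add: word_dual dual_word_def rev_map comp_def flip: word_inject)

lemma weight_dual [simp]: "weight (dual a) = weight a"
  by (simp add: word_dual dual_word_def flip: length_word)


section \<open>Classes of admissible compositions modulo duality\<close>

quotient_type bclass = acomp / "\<lambda>a b. b = a \<or> b = dual a"
  morphisms rep_bclass cls
  by (intro equivpI reflpI sympI transpI) auto


section \<open>The maps init, fin, mid and \<open>\<delta>\<close>\<close>

lift_definition init :: "acomp \<Rightarrow> acomp" is butlast
proof -
  fix a :: "nat list"
  assume a: "(\<forall>i\<in>set a. 1 \<le> i) \<and> (a = [] \<or> 2 \<le> hd a)"
  show "(\<forall>i\<in>set (butlast a). 1 \<le> i) \<and> (butlast a = [] \<or> 2 \<le> hd (butlast a))"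
  proof (cases a rule: rev_cases)
    case (snoc b n)
    with a show ?thesis by (cases b) auto
  qed simp
qed

definition fin :: "acomp \<Rightarrow> acomp" where
  "fin a = dual (init (dual a))"

definition mid :: "acomp \<Rightarrow> acomp" where
  "mid a = init (fin a)"

definition linit :: "(acomp \<Rightarrow>\<^sub>0 int) \<Rightarrow> (acomp \<Rightarrow>\<^sub>0 int)" where
  "linit = frag_extend (\<lambda>a. frag_of (init a))"

definition bclass_span :: "nat \<Rightarrow> (bclass \<Rightarrow>\<^sub>0 int) set" where
  "bclass_span k = {x. Poly_Mapping.keys x \<subseteq> cls ` {a. weight a = k}}"

definition acomp_span :: "nat \<Rightarrow> (acomp \<Rightarrow>\<^sub>0 int) set" where
  "acomp_span k = {x. Poly_Mapping.keys x \<subseteq> {a. weight a = k}}"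

definition is_delta :: "((bclass \<Rightarrow>\<^sub>0 int) \<Rightarrow> (acomp \<Rightarrow>\<^sub>0 int)) \<Rightarrow> bool" where
  "is_delta d \<longleftrightarrow>
     module_hom frag_cmul frag_cmul d \<and>
     (\<forall>k. d ` bclass_span k \<subseteq> acomp_span k) \<and>
     d (frag_of (cls empty_acomp)) = frag_of empty_acomp \<and>
     (\<forall>a. a \<noteq> empty_acomp \<longrightarrow>
        linit (d (frag_of (cls a))) =
          d (frag_of (cls (init a))) + d (frag_of (cls (mid a))) + d (frag_of (cls (fin a))))"

definition delta :: "(bclass \<Rightarrow>\<^sub>0 int) \<Rightarrow> (acomp \<Rightarrow>\<^sub>0 int)" where
  "delta = (THE d. is_delta d)"


section \<open>Existence and uniqueness of \<open>\<delta>\<close>\<close>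

lemma weight_init: "a \<noteq> empty_acomp \<Longrightarrow> weight (init a) < weight a"
proof transfer
  fix a :: "nat list"
  assume "(\<forall>i\<in>set a. 1 \<le> i) \<and> (a = [] \<or> 2 \<le> hd a)" "a \<noteq> []"
  then show "sum_list (butlast a) < sum_list a"
    by (cases a rule: rev_cases) auto
qed

lemma weight_eq_0_iff: "weight a = 0 \<longleftrightarrow> a = empty_acomp"
  by (metis length_0_conv length_word word_eq_Nil_iff)

lemma dual_empty [simp]: "dual empty_acomp = empty_acomp"
  by (metis weight_dual weight_eq_0_iff)

lemma init_empty [simp]: "init empty_acomp = empty_acomp"
  by transfer simp

lemma weight_fin: "a \<noteq> empty_acomp \<Longrightarrow> weight (fin a) < weight a"
  unfolding fin_def by (metis dual_dual dual_empty weight_dual weight_init)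

lemma weight_mid: "a \<noteq> empty_acomp \<Longrightarrow> weight (mid a) < weight a"
  unfolding mid_def by (metis init_empty less_trans weight_fin weight_init)

lemma weight_ge_2: "a \<noteq> empty_acomp \<Longrightarrow> 2 \<le> weight a"
proof transfer
  fix a :: "nat list"
  assume "(\<forall>i\<in>set a. 1 \<le> i) \<and> (a = [] \<or> 2 \<le> hd a)" "a \<noteq> []"
  then show "2 \<le> sum_list a"
    by (cases a) auto
qed

lemma list_word_butlast:
  "list_word (butlast a) = rev (dropWhile Not (tl (rev (list_word a))))"
proof (cases a rule: rev_cases)
  case (snoc b n)
  have "dropWhile Not (rev (list_word b)) = rev (list_word b)"
    by (cases b rule: rev_cases) auto
  with snoc show ?thesis
    by (simp add: dropWhile_append)
qed simp

lemma word_fin: "word (fin a) = dropWhile id (tl (word a))"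
proof -
  have "word (init b) = rev (dropWhile Not (tl (rev (word b))))" for b
    by transfer (rule list_word_butlast)
  then have "word (fin a) = map Not (dropWhile Not (tl (map Not (word a))))"
    by (simp add: fin_def word_dual dual_word_def rev_map)
  also have "\<dots> = dropWhile id (tl (word a))"
    by (simp add: dropWhile_map comp_def id_def flip: map_tl)
  finally show ?thesis .
qed

lemma dropWhile_list_word:
  "\<forall>i\<in>set a. 1 \<le> i \<Longrightarrow> dropWhile id (list_word a) = list_word (dropWhile (\<lambda>i. i = 1) a)"
proof (induction a)
  case (Cons n a)
  show ?case
  proof (cases "n = 1")
    case False
    with Cons.prems obtain m where "n = Suc (Suc m)"
      by (metis One_nat_def Suc_le_D list.set_intros(1) not0_implies_Suc)
    then show ?thesis by simp
  qed (use Cons in simp)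
qed simp

definition list_fin :: "nat list \<Rightarrow> nat list" where
  "list_fin a = (if a = [] then [] else if hd a = 2 then dropWhile (\<lambda>i. i = 1) (tl a)
     else (hd a - 1) # tl a)"

lemma entries_fin: "entries (fin a) = list_fin (entries a)"
proof -
  have a: "\<forall>i\<in>set (entries a). 1 \<le> i" "entries a = [] \<or> 2 \<le> hd (entries a)"
    using entries[of a] by auto
  have *: "(\<forall>i\<in>set (list_fin (entries a)). 1 \<le> i)"
    using a by (cases "entries a") (auto simp: list_fin_def dest: set_dropWhileD)
  have "list_word (entries (fin a)) = dropWhile id (tl (list_word (entries a)))"
    using word_fin[of a] by (simp add: word.rep_eq)
  also have "\<dots> = list_word (list_fin (entries a))"
  proof (cases "entries a")
    case (Cons n b)
    with a obtain m where m: "n = Suc (Suc m)"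
      by (metis Suc_le_D list.distinct(1) list.sel(1) numeral_2_eq_2 Suc_le_mono)
    show ?thesis
      using a Cons m dropWhile_list_word[of b]
      by (cases m) (auto simp: list_fin_def)
  qed (simp add: list_fin_def)
  finally show ?thesis
    using list_word_inject * entries[of "fin a"] by auto
qed

lemma butlast_dropWhile: "butlast (dropWhile P xs) = dropWhile P (butlast xs)"
proof (induction xs)
  case (Cons x xs)
  then show ?case by (cases xs) auto
qed simp

lemma fin_init: "fin (init a) = init (fin a)"
proof -
  have "list_fin (butlast b) = butlast (list_fin b)" for b
    by (cases b) (auto simp: list_fin_def butlast_dropWhile)
  then have "entries (fin (init a)) = entries (init (fin a))"
    by (simp add: entries_fin init.rep_eq)
  then show ?thesis
    by (simp add: entries_inject)
qed

lemma init_dual: "init (dual a) = dual (fin a)"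
  by (simp add: fin_def)

lemma fin_dual: "fin (dual a) = dual (init a)"
  by (simp add: fin_def)

lemma mid_dual: "mid (dual a) = dual (mid a)"
  by (metis fin_def fin_init init_dual mid_def dual_dual)

text \<open>The inverse of \<^const>\<open>init\<close> from compositions of weight less than \<open>k\<close> to weight \<open>k\<close>.\<close>

definition extend :: "nat \<Rightarrow> acomp \<Rightarrow> acomp" where
  "extend k a = Acomp (entries a @ [k - weight a])"

lemma entries_extend:
  assumes "weight a < k" "2 \<le> k"
  shows "entries (extend k a) = entries a @ [k - weight a]"
proof -
  have "weight a = 0" if "entries a = []"
    using that by (simp add: weight.rep_eq)
  then show ?thesis
    unfolding extend_def using assms entries[of a]
    by (intro Acomp_inverse) (cases "entries a", auto)
qed

lemma init_extend: "weight a < k \<Longrightarrow> 2 \<le> k \<Longrightarrow> init (extend k a) = a"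
  by (simp add: init.rep_eq entries_extend flip: entries_inject)

lemma weight_extend: "weight a < k \<Longrightarrow> 2 \<le> k \<Longrightarrow> weight (extend k a) = k"
  using entries_extend[of a k] by (simp add: weight.rep_eq)

lemma extend_init:
  assumes "a \<noteq> empty_acomp"
  shows "extend (weight a) (init a) = a"
proof -
  have "entries a \<noteq> []"
    using assms by (metis empty_acomp.rep_eq entries_inject)
  then obtain b n where "entries a = b @ [n]"
    by (cases "entries a" rule: rev_cases) auto
  moreover have "entries (extend (weight a) (init a)) = entries (init a) @ [weight a - weight (init a)]"
    using assms by (intro entries_extend weight_init weight_ge_2)
  ultimately have "entries (extend (weight a) (init a)) = entries a"
    by (simp add: weight.rep_eq init.rep_eq)
  then show ?thesis
    by (simp add: entries_inject)
qed

function delta_rec :: "acomp \<Rightarrow> (acomp \<Rightarrow>\<^sub>0 int)" where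
  "delta_rec a = (if a = empty_acomp then frag_of empty_acomp
     else frag_extend (\<lambda>b. frag_of (extend (weight a) b))
            (delta_rec (init a) + delta_rec (mid a) + delta_rec (fin a)))"
  by auto
termination
  by (relation "measure weight") (simp_all add: weight_init weight_mid weight_fin)

declare delta_rec.simps [simp del]

lemma delta_rec_dual: "delta_rec (dual a) = delta_rec a"
proof (induction a rule: delta_rec.induct)
  case (1 a)
  show ?case
  proof (cases "a = empty_acomp")
    case False
    then have "dual a \<noteq> empty_acomp"
      by (metis dual_dual dual_empty)
    with False show ?thesis
      using 1[OF False]
      by (simp add: delta_rec.simps[of a] delta_rec.simps[of "dual a"] init_dual fin_dual mid_dual
          add_ac)
  qed simp
qed

lemma keys_delta_rec_sum:
  assumes "\<And>b. b \<in> {init a, mid a, fin a} \<Longrightarrow> delta_rec b \<in> acomp_span (weight b)"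
    and "a \<noteq> empty_acomp"
    and "b \<in> Poly_Mapping.keys (delta_rec (init a) + delta_rec (mid a) + delta_rec (fin a))"
  shows "weight b < weight a"
proof -
  have "b \<in> Poly_Mapping.keys (delta_rec (init a)) \<union> Poly_Mapping.keys (delta_rec (mid a))
      \<union> Poly_Mapping.keys (delta_rec (fin a))"
    using assms(3) keys_add[of "delta_rec (init a) + delta_rec (mid a)" "delta_rec (fin a)"]
      keys_add[of "delta_rec (init a)" "delta_rec (mid a)"] by blast
  moreover have "weight b = weight c"
    if "c \<in> {init a, mid a, fin a}" "b \<in> Poly_Mapping.keys (delta_rec c)" for c
    using assms(1)[OF that(1)] that(2) by (auto simp: acomp_span_def)
  ultimately have "weight b \<in> {weight (init a), weight (mid a), weight (fin a)}"
    by auto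
  then show ?thesis
    using weight_init[OF assms(2)] weight_mid[OF assms(2)] weight_fin[OF assms(2)] by auto
qed

lemma delta_rec_span: "delta_rec a \<in> acomp_span (weight a)"
proof (induction a rule: delta_rec.induct)
  case (1 a)
  show ?case
  proof (cases "a = empty_acomp")
    case True
    then show ?thesis by (simp add: delta_rec.simps[of empty_acomp] acomp_span_def)
  next
    case False
    note b = keys_delta_rec_sum[of a, OF _ False]
    have "Poly_Mapping.keys (delta_rec a) \<subseteq>
      extend (weight a) ` Poly_Mapping.keys (delta_rec (init a) + delta_rec (mid a) + delta_rec (fin a))"
      using False by (subst delta_rec.simps) (auto dest!: subsetD[OF keys_frag_extend])
    also have "\<dots> \<subseteq> {c. weight c = weight a}"
      using b 1[OF False] weight_ge_2[OF False] by (auto intro!: weight_extend)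
    finally show ?thesis
      by (simp add: acomp_span_def)
  qed
qed

lemma linit_extend:
  assumes "\<And>b. b \<in> Poly_Mapping.keys x \<Longrightarrow> weight b < k" "2 \<le> k"
  shows "linit (frag_extend (\<lambda>b. frag_of (extend k b)) x) = x"
proof -
  have "linit (frag_extend (\<lambda>b. frag_of (extend k b)) x) = frag_extend (\<lambda>b. frag_of (init (extend k b))) x"
    using frag_extend_compose[of "\<lambda>a. frag_of (init a)" "extend k" x] by (simp add: linit_def comp_def)
  also have "\<dots> = frag_extend frag_of x"
    using assms by (intro frag_extend_eq) (simp add: init_extend)
  finally show ?thesis
    by (simp flip: frag_expansion)
qed

lemma extend_linit:
  assumes "x \<in> acomp_span k" "k \<noteq> 0"
  shows "frag_extend (\<lambda>b. frag_of (extend k b)) (linit x) = x"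
proof -
  have "frag_extend (\<lambda>b. frag_of (extend k b)) (linit x) = frag_extend (\<lambda>b. frag_of (extend k (init b))) x"
    using frag_extend_compose[of "\<lambda>b. frag_of (extend k b)" init x] by (simp add: linit_def comp_def)
  also have "\<dots> = frag_extend frag_of x"
  proof (rule frag_extend_eq)
    fix b
    assume "b \<in> Poly_Mapping.keys x"
    with assms have "weight b = k" "b \<noteq> empty_acomp"
      by (auto simp: acomp_span_def simp flip: weight_eq_0_iff)
    then show "frag_of (extend k (init b)) = frag_of b"
      using extend_init[of b] by simp
  qed
  finally show ?thesis
    by (simp flip: frag_expansion)
qed

lemma module_frag_cmul: "module frag_cmul"
  by unfold_locales (simp_all add: frag_cmul_distrib frag_cmul_distrib2)

lemma cls_eq_iff: "cls a = cls b \<longleftrightarrow> b = a \<or> b = dual a"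
  by (rule bclass.abs_eq_iff)

lemma rep_bclass_cases: "rep_bclass (cls a) = a \<or> rep_bclass (cls a) = dual a"
  using Quotient_abs_rep[OF Quotient_bclass, of "cls a"] cls_eq_iff[of a "rep_bclass (cls a)"]
  by auto

lemma is_delta_exists: "is_delta (frag_extend (\<lambda>c. delta_rec (rep_bclass c)))"
proof -
  let ?d = "frag_extend (\<lambda>c. delta_rec (rep_bclass c))"
  have rep: "delta_rec (rep_bclass (cls a)) = delta_rec a" for a
    using rep_bclass_cases[of a] by (auto simp: delta_rec_dual)
  have hom: "module_hom frag_cmul frag_cmul ?d"
    by (intro module_hom.intro module_hom_axioms.intro module_frag_cmul)
      (simp_all add: frag_extend_add frag_extend_cmul)
  have "?d x \<in> acomp_span k" if x: "x \<in> bclass_span k" for x k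
  proof -
    have "Poly_Mapping.keys (delta_rec (rep_bclass c)) \<subseteq> {a. weight a = k}"
      if "c \<in> Poly_Mapping.keys x" for c
    proof -
      from that x obtain a where "c = cls a" "weight a = k"
        by (auto simp: bclass_span_def)
      then show ?thesis
        using delta_rec_span[of a] by (simp add: rep acomp_span_def)
    qed
    then show ?thesis
      unfolding acomp_span_def by (auto dest!: subsetD[OF keys_frag_extend])
  qed
  moreover have "linit (delta_rec a) = delta_rec (init a) + delta_rec (mid a) + delta_rec (fin a)"
    if "a \<noteq> empty_acomp" for a
  proof -
    have "linit (delta_rec a) = linit (frag_extend (\<lambda>b. frag_of (extend (weight a) b))
        (delta_rec (init a) + delta_rec (mid a) + delta_rec (fin a)))"
      using that by (subst delta_rec.simps) simp
    also have "\<dots> = delta_rec (init a) + delta_rec (mid a) + delta_rec (fin a)"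
      by (rule linit_extend[OF keys_delta_rec_sum[OF delta_rec_span that] weight_ge_2[OF that]])
    finally show ?thesis .
  qed
  ultimately show ?thesis
    using hom by (auto simp: is_delta_def rep delta_rec.simps[of empty_acomp])
qed

lemma is_delta_frag_of_cls:
  assumes "is_delta d"
  shows "d (frag_of (cls a)) = delta_rec a"
proof (induction a rule: delta_rec.induct)
  case (1 a)
  show ?case
  proof (cases "a = empty_acomp")
    case True
    with assms show ?thesis
      by (simp add: delta_rec.simps[of empty_acomp] is_delta_def)
  next
    case False
    have "frag_of (cls a) \<in> bclass_span (weight a)"
      by (simp add: bclass_span_def)
    with assms have "d (frag_of (cls a)) \<in> acomp_span (weight a)"
      by (auto simp: is_delta_def)
    then have "d (frag_of (cls a)) =
        frag_extend (\<lambda>b. frag_of (extend (weight a) b)) (linit (d (frag_of (cls a))))"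
      using False by (simp add: extend_linit weight_eq_0_iff)
    also have "\<dots> = delta_rec a"
      using assms False 1[OF False] by (simp add: is_delta_def delta_rec.simps[of a])
    finally show ?thesis .
  qed
qed

lemma ex1_is_delta: "\<exists>!d. is_delta d"
proof (rule ex_ex1I)
  show "\<exists>d. is_delta d"
    using is_delta_exists by blast
next
  fix d d'
  assume d: "is_delta d" and d': "is_delta d'"
  then interpret d: module_hom frag_cmul frag_cmul d + d': module_hom frag_cmul frag_cmul d'
    by (simp_all add: is_delta_def)
  have "d x = d' x" for x
  proof (rule frag_induction[where S = UNIV and c = x and P = "\<lambda>x. d x = d' x"])
    fix c
    obtain a where "c = cls a"
      by (metis Quotient_abs_rep[OF Quotient_bclass])
    then show "d (frag_of c) = d' (frag_of c)"
      by (simp add: is_delta_frag_of_cls d d')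
  qed (simp_all add: d.diff d'.diff)
  then show "d = d'" by (rule ext)
qed

lemma is_delta_delta: "is_delta delta"
  unfolding delta_def using ex1_is_delta by (rule theI')

end

theory Submission
  imports Defs
begin

text \<open>For \<open>a > 2\<close> both \<open>(a)\<^sup>i\<^sup>n\<^sup>i\<^sup>t\<close> and \<open>(a)\<^sup>m\<^sup>i\<^sup>d\<close> are empty while \<open>(a)\<^sup>f\<^sup>i\<^sup>n = (a - 1)\<close>, so
  \<open>\<delta>([a])\<close> is twice \<open>(a)\<close> plus \<open>\<delta>([a - 1])\<close> with an entry \<open>1\<close> appended to every composition. For
  \<open>a = 2\<close> all three truncations are empty, which gives the coefficient \<open>3\<close>.\<close>

lemma entries_Acomp_Cons:
  "2 \<le> n \<Longrightarrow> \<forall>i\<in>set b. 1 \<le> i \<Longrightarrow> entries (Acomp (n # b)) = n # b"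
  by (rule Acomp_inverse) auto

lemma Acomp_Cons_neq_empty:
  "2 \<le> n \<Longrightarrow> \<forall>i\<in>set b. 1 \<le> i \<Longrightarrow> Acomp (n # b) \<noteq> empty_acomp"
  by (metis empty_acomp.rep_eq entries_Acomp_Cons list.distinct(1))

lemma weight_Acomp_Cons:
  "2 \<le> n \<Longrightarrow> \<forall>i\<in>set b. 1 \<le> i \<Longrightarrow> weight (Acomp (n # b)) = n + sum_list b"
  by (simp add: weight.rep_eq entries_Acomp_Cons)

lemma init_single: "2 \<le> n \<Longrightarrow> init (Acomp [n]) = empty_acomp"
  by (simp add: init.rep_eq entries_Acomp_Cons empty_acomp.rep_eq flip: entries_inject)

text \<open>On the word \<open>0^(n-1) 1\<close>, \<open>fin\<close> deletes the leading 0; for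
  \<open>n = 2\<close> the remaining 1 is dropped as well, since an admissible word cannot begin
  with 1.\<close>

lemma fin_single:
  "2 \<le> n \<Longrightarrow> fin (Acomp [n]) = (if n = 2 then empty_acomp else Acomp [n - 1])"
  by (simp add: entries_fin list_fin_def entries_Acomp_Cons empty_acomp.rep_eq flip: entries_inject)

lemma mid_single: "2 \<le> n \<Longrightarrow> mid (Acomp [n]) = empty_acomp"
  by (simp add: mid_def fin_single init_single)

lemma extend_empty: "extend k empty_acomp = Acomp [k]"
  by (simp add: extend_def empty_acomp.rep_eq weight.rep_eq)

text \<open>The hook has weight \<open>k\<close>, so the entry that completes it to weight
  \<open>Suc k\<close> is 1 and joins the tail of ones.\<close>

lemma extend_hook:
  assumes "2 \<le> b" "b \<le> k"
  shows "extend (Suc k) (Acomp (b # replicate (k - b) 1)) = Acomp (b # replicate (Suc k - b) 1)"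
proof -
  have "replicate (k - b) (1::nat) @ [1] = replicate (Suc k - b) 1"
    using assms by (simp add: Suc_diff_le replicate_append_same)
  then show ?thesis
    using assms by (simp add: extend_def entries_Acomp_Cons weight_Acomp_Cons sum_list_replicate)
qed

lemma delta_rec_single_2: "delta_rec (Acomp [2]) = frag_cmul 3 (frag_of (Acomp [2]))"
proof -
  let ?e = "frag_of empty_acomp"
  have "?e + ?e + ?e = frag_cmul 3 ?e"
    by (rule poly_mapping_eqI) (simp add: lookup_add)
  then show ?thesis
    by (simp add: delta_rec.simps[of "Acomp [2]"] delta_rec.simps[of empty_acomp]
        Acomp_Cons_neq_empty init_single mid_single fin_single weight_Acomp_Cons
        frag_extend_cmul extend_empty)
qed

lemma delta_rec_single_Suc:
  assumes "2 \<le> n"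
  shows "delta_rec (Acomp [Suc n]) = frag_cmul 2 (frag_of (Acomp [Suc n])) +
    frag_extend (\<lambda>b. frag_of (extend (Suc n) b)) (delta_rec (Acomp [n]))"
proof -
  let ?e = "frag_of empty_acomp"
  have "?e + ?e = frag_cmul 2 ?e"
    by (rule poly_mapping_eqI) (simp add: lookup_add)
  with assms show ?thesis
    by (simp add: delta_rec.simps[of "Acomp [Suc n]"] delta_rec.simps[of empty_acomp]
        Acomp_Cons_neq_empty init_single mid_single fin_single weight_Acomp_Cons
        frag_extend_add frag_extend_cmul extend_empty)
qed

lemma delta_rec_single:
  assumes "2 \<le> a"
  shows "delta_rec (Acomp [a]) =
    frag_cmul 2 (\<Sum>b = 3..a. frag_of (Acomp (b # replicate (a - b) 1)))
      + frag_cmul 3 (frag_of (Acomp (2 # replicate (a - 2) 1)))"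
  using assms
proof (induction a rule: dec_induct)
  case base
  \<comment> \<open>The sum over \<open>3..2\<close> is empty and the tail of ones has length
    0.\<close>
  then show ?case by (simp add: delta_rec_single_2)
next
  case (step n)
  have "frag_extend (\<lambda>b. frag_of (extend (Suc n) b))
      (\<Sum>b = 3..n. frag_of (Acomp (b # replicate (n - b) 1)))
    = (\<Sum>b = 3..n. frag_of (Acomp (b # replicate (Suc n - b) 1)))"
    by (simp add: frag_extend_sum comp_def extend_hook del: One_nat_def)
  moreover have "extend (Suc n) (Acomp (2 # replicate (n - 2) 1))
      = Acomp (2 # replicate (Suc n - 2) 1)"
    using step by (intro extend_hook) auto
  \<comment> \<open>The term \<open>frag_cmul 2 (frag_of (Acomp [Suc n]))\<close> of the recursion
    is the new summand \<open>b = Suc n\<close>, whose tail of ones is empty.\<close>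
  ultimately show ?case
    using step by (simp add: delta_rec_single_Suc frag_extend_add frag_extend_cmul
        frag_cmul_distrib2 add_ac del: One_nat_def)
qed

theorem theorem12:
  fixes a :: nat
  assumes "2 \<le> a"
  shows "delta (frag_of (cls (Acomp [a]))) =
    frag_cmul 2 (\<Sum>b = 3..a. frag_of (Acomp (b # replicate (a - b) 1)))
      + frag_cmul 3 (frag_of (Acomp (2 # replicate (a - 2) 1)))"
  \<comment> \<open>Every map satisfying \<open>is_delta\<close> takes the values of
    \<open>delta_rec\<close> on the classes, hence so does \<open>delta\<close>.\<close>
  using delta_rec_single[OF assms] by (simp add: is_delta_frag_of_cls[OF is_delta_delta])

end
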